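(* Let $\mathsf{k}$ be a field and let $A=\bigoplus_{n\ge 0}A_n$ be an affine $\mathbb{N}$-graded $\mathsf{k}$-algebra with all $A_n$ finite dimensional. If $\mathrm{H}(A)>1$, then $\mathsf{DIM}(A)=1$.
   Context: All algebras are associative and unital over an arbitrary base field $\mathsf{k}$; $\mathbb{N}=\{0,1,2,\dots\}$. An algebra is affine if it is finitely generated as an algebra. $\mathbb{N}$-graded means $A=\bigoplus_{n\ge0}A_n$ with subspaces $A_n$ satisfying $A_nA_m\subseteq A_{n+m}$. The entropy of $A$ is $\mathrm{H}(A)=\limsup_{n\to\infty}\sqrt[n]{\dim A_n}$. For an affine algebra $A$ and a finite-dimensional subspace $V\subseteq A$ containing $1$ and generating $A$ as an algebra, let $V^0=\mathsf{k}$, $V^n=\operatorname{span}\{a_1\cdots a_n: a_j\in V\}$ for $n>0$, and $d_V(n)=\dim V^n$. The Gelfand-Kirillov superdimension of $A$ is $\mathsf{DIM}(A)=\limsup_{n\to\infty}\frac{\log\log d_V(n)}{\log n}$, which is independent of the choice of $V$. *)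

theory Defs
  imports Complex_Main "HOL-Library.Extended_Real"
begin

text \<open>An algebra is a whole type of class \<^class>\<open>ring_1\<close> with a scalar multiplication making it
  a vector space over the field. The class excludes the zero ring.\<close>

locale unital_algebra = vector_space scale
  for scale :: "'k::field \<Rightarrow> 'a::ring_1 \<Rightarrow> 'a" +
  assumes scale_mult_left: "scale c x * y = scale c (x * y)"
    and scale_mult_right: "x * scale c y = scale c (x * y)"
begin

definition subalgebra :: "'a set \<Rightarrow> bool" where
  "subalgebra S \<longleftrightarrow> subspace S \<and> 1 \<in> S \<and> (\<forall>x\<in>S. \<forall>y\<in>S. x * y \<in> S)"

definition generates :: "'a set \<Rightarrow> bool" where
  "generates X \<longleftrightarrow> subalgebra hull X = UNIV"

definition affine :: bool where
  "affine \<longleftrightarrow> (\<exists>X. finite X \<and> generates X)"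

text \<open>Needed besides \<^const>\<open>dim\<close>, which is 0 on infinite-dimensional subspaces.\<close>

definition finite_dim :: "'a set \<Rightarrow> bool" where
  "finite_dim V \<longleftrightarrow> (\<exists>B. finite B \<and> V \<subseteq> span B)"

definition graded :: "(nat \<Rightarrow> 'a set) \<Rightarrow> bool" where
  "graded A \<longleftrightarrow>
     (\<forall>n. subspace (A n)) \<and>
     (\<forall>x. \<exists>!f. (\<forall>n. f n \<in> A n) \<and> finite {n. f n \<noteq> 0} \<and> x = (\<Sum>n | f n \<noteq> 0. f n)) \<and>
     (\<forall>n m. \<forall>x\<in>A n. \<forall>y\<in>A m. x * y \<in> A (n + m))"

definition entropy :: "(nat \<Rightarrow> 'a set) \<Rightarrow> ereal" where
  "entropy A = limsup (\<lambda>n. ereal (root n (real (dim (A n)))))"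

text \<open>For \<open>n = 0\<close> the only product is the empty one, so this is the line spanned by 1.\<close>

definition subspace_power :: "'a set \<Rightarrow> nat \<Rightarrow> 'a set" where
  "subspace_power V n = span {prod_list as | as. length as = n \<and> set as \<subseteq> V}"

definition generating_subspace :: "'a set \<Rightarrow> bool" where
  "generating_subspace V \<longleftrightarrow> subspace V \<and> finite_dim V \<and> 1 \<in> V \<and> generates V"

text \<open>Since \<^term>\<open>ln 0 = (0::real)\<close>, the one-dimensional algebra gets the value 0, like every
  other finite-dimensional algebra.\<close>

definition superdim_wrt :: "'a set \<Rightarrow> ereal" where
  "superdim_wrt V =
     limsup (\<lambda>n. ereal (ln (ln (real (dim (subspace_power V n)))) / ln (real n)))"

text \<open>The value common to all generating subspaces; it is meaningful for affine algebras, where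
  generating subspaces exist and all give the same value.\<close>

definition GK_superdim :: ereal where
  "GK_superdim = (THE d. \<exists>V. generating_subspace V \<and> d = superdim_wrt V)"

end

end

theory Submission
  imports Defs
begin

text \<open>Let \<open>V\<close> be any generating subspace, with growth function \<open>d n = dim (V ^ n)\<close>; it will be
  shown directly that \<open>V\<close> gives the value 1, so that the independence of the choice of \<open>V\<close> comes
  out along the way.

  The upper bound holds in every affine algebra: \<open>V ^ n\<close> is spanned by the words of length \<open>n\<close> in
  a basis of \<open>V\<close>, so \<open>d\<close> grows at most exponentially (lemma \<open>dim_subspace_power_le\<close>), and
  \<open>ln (ln (C ^ n)) = ln n + ln (ln C)\<close> is asymptotic to \<open>ln n\<close>.

  For the lower bound, choose \<open>r\<close> so large that \<open>W = A 0 + \<dots> + A r\<close> contains \<open>V\<close>. Then \<open>W\<close> consists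
  of generators of bounded degree, and an element of \<open>A n\<close> is a combination of words in homogeneous
  elements of \<open>W\<close> of total degree \<open>n\<close>. Such words may be long, but only because of letters of
  degree 0; each of these can be absorbed by a neighbouring letter, since \<open>A 0 * A i \<subseteq> A i\<close>. What is
  left are at most \<open>n\<close> letters of positive degree. So \<open>A n \<subseteq> W ^ n\<close> for \<open>n > 0\<close>
  (lemma \<open>component_subset_subspace_power\<close>). As \<open>W\<close> is finite-dimensional, it lies in some
  \<open>V ^ s\<close>, and therefore \<open>dim (A n) \<le> d (s * n)\<close> with \<open>s\<close> independent of \<open>n\<close>. Entropy above 1 means
  that \<open>dim (A n)\<close> exceeds \<open>c ^ n\<close> for some \<open>c > 1\<close> and infinitely many \<open>n\<close>. The passage from \<open>n\<close> to
  \<open>s * n\<close> changes \<open>ln n\<close> only by a constant, so the double logarithm does not notice it.\<close>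

section \<open>Double logarithms of exponentially growing sequences\<close>

lemma ln_ln_power_ratio_tendsto_1:
  fixes c s :: real
  assumes "c > 1" "s > 0"
  shows "(\<lambda>n. ln (ln (c ^ n)) / ln (s * real n)) \<longlonglongrightarrow> 1"
proof -
  have lim: "filterlim (\<lambda>n. ln (real n)) at_top sequentially"
    by (rule filterlim_compose[OF ln_at_top filterlim_real_sequentially])
  have zero: "(\<lambda>n. k / ln (real n)) \<longlonglongrightarrow> 0" for k :: real
    by (rule real_tendsto_divide_at_top[OF tendsto_const lim])
  have "(\<lambda>n. (1 + ln (ln c) / ln (real n)) / (1 + ln s / ln (real n))) \<longlonglongrightarrow> (1 + 0) / (1 + 0)"
    by (intro tendsto_intros zero) auto
  moreover have "\<forall>\<^sub>F n in sequentially.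
      (1 + ln (ln c) / ln (real n)) / (1 + ln s / ln (real n)) = ln (ln (c ^ n)) / ln (s * real n)"
    using eventually_gt_at_top[of 1]
  proof eventually_elim
    case (elim n)
    have pos: "ln (real n) > 0"
      using elim by simp
    have "ln (ln (c ^ n)) = ln (real n) + ln (ln c)"
      using assms elim by (simp add: ln_realpow ln_mult)
    moreover have "ln (s * real n) = ln (real n) + ln s"
      using assms elim by (simp add: ln_mult)
    moreover have "(1 + ln (ln c) / ln (real n)) = (ln (real n) + ln (ln c)) / ln (real n)"
      "(1 + ln s / ln (real n)) = (ln (real n) + ln s) / ln (real n)"
      using pos by (simp_all add: field_simps)
    ultimately show ?case
      using pos by simp
  qed
  ultimately show ?thesis
    by (simp add: tendsto_cong)
qed

lemma limsup_ln_ln_ratio_le_1: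
  fixes d :: "nat \<Rightarrow> nat" and C :: real
  assumes C: "C \<ge> 3" and le: "\<And>n. real (d n) \<le> C ^ n"
  shows "limsup (\<lambda>n. ereal (ln (ln (real (d n))) / ln (real n))) \<le> 1"
proof -
  let ?g = "\<lambda>n. ln (ln (C ^ n)) / ln (1 * real n)"
  have lnC: "ln C \<ge> 1"
    using C exp_le ln_ge_iff[of C 1] by simp
  have "\<forall>\<^sub>F n in sequentially. ereal (ln (ln (real (d n))) / ln (real n)) \<le> ereal (?g n)"
    using eventually_gt_at_top[of 1]
  proof eventually_elim
    case (elim n)
    have ge1: "ln (C ^ n) \<ge> 1"
      using C lnC elim mult_mono[of 1 "real n" 1 "ln C"] by (simp add: ln_realpow)
    have "ln (ln (real (d n))) \<le> ln (ln (C ^ n))"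
    proof (cases "d n \<le> 1")
      \<comment> \<open>Here the convention \<open>ln 0 = 0\<close> makes the left-hand side 0.\<close>
      case True
      then have "d n = 0 \<or> d n = 1"
        by linarith
      then show ?thesis
        using ge1 by auto
    next
      case False
      then have "ln (real (d n)) > 0"
        by simp
      moreover have "ln (real (d n)) \<le> ln (C ^ n)"
        using False C le[of n] by (intro ln_mono) auto
      ultimately show ?thesis
        by simp
    qed
    then show ?case
      using elim by (simp add: divide_right_mono)
  qed
  then have "limsup (\<lambda>n. ereal (ln (ln (real (d n))) / ln (real n))) \<le> limsup (\<lambda>n. ereal (?g n))"
    by (rule Limsup_mono)
  also have "\<dots> = 1"
  proof -
    have "?g \<longlonglongrightarrow> 1"
      using C by (intro ln_ln_power_ratio_tendsto_1) auto
    then have "(\<lambda>n. ereal (?g n)) \<longlonglongrightarrow> ereal 1"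
      by (rule tendsto_ereal)
    then show ?thesis
      using lim_imp_Limsup[OF trivial_limit_sequentially] by (metis one_ereal_def)
  qed
  finally show ?thesis .
qed

text \<open>Along the infinitely many indices \<open>s * n\<close> at which \<open>d\<close> is bounded below by \<open>c ^ n\<close>, the quotient
  is bounded below by a sequence with limit 1; a limsup needs no more than such a subsequence.\<close>

lemma limsup_ln_ln_ratio_ge_1:
  fixes d :: "nat \<Rightarrow> nat" and c :: real and s :: nat
  assumes c: "c > 1" and s: "s > 0"
    and freq: "\<exists>\<^sub>F n in sequentially. c ^ n \<le> real (d (s * n))"
  shows "limsup (\<lambda>n. ereal (ln (ln (real (d n))) / ln (real n))) \<ge> 1"
proof -
  let ?f = "\<lambda>n. ereal (ln (ln (real (d n))) / ln (real n))"
  let ?g = "\<lambda>n. ln (ln (c ^ n)) / ln (real s * real n)"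
  have "infinite {n. c ^ n \<le> real (d (s * n))}"
    using freq by (simp add: frequently_cofinite cofinite_eq_sequentially[symmetric])
  then obtain q :: "nat \<Rightarrow> nat" where q: "strict_mono q" "\<And>n. c ^ q n \<le> real (d (s * q n))"
    using infinite_enumerate by blast
  have sq: "strict_mono (\<lambda>n. s * q n)"
    using q(1) s by (auto simp: strict_mono_def)
  have "?g \<longlonglongrightarrow> 1"
    using c s by (intro ln_ln_power_ratio_tendsto_1) auto
  then have "(?g \<circ> q) \<longlonglongrightarrow> 1"
    using q(1) by (rule LIMSEQ_subseq_LIMSEQ)
  then have "(\<lambda>n. ereal (?g (q n))) \<longlonglongrightarrow> ereal 1"
    by (intro tendsto_ereal) (simp add: o_def)
  then have "1 = limsup (\<lambda>n. ereal (?g (q n)))"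
    using lim_imp_Limsup[OF trivial_limit_sequentially] by (metis one_ereal_def)
  also have "\<dots> \<le> limsup (\<lambda>n. ?f (s * q n))"
  proof (rule Limsup_mono)
    show "\<forall>\<^sub>F n in sequentially. ereal (?g (q n)) \<le> ?f (s * q n)"
      using eventually_gt_at_top[of 0]
    proof eventually_elim
      case (elim n)
      have qn: "q n > 0"
        using elim strict_mono_imp_increasing[OF q(1), of n] by linarith
      have pos: "ln (c ^ q n) > 0"
        using c qn by (simp add: ln_realpow)
      have "ln (c ^ q n) \<le> ln (real (d (s * q n)))"
        using q(2)[of n] c by (intro ln_mono) auto
      then have "ln (ln (c ^ q n)) \<le> ln (ln (real (d (s * q n))))"
        using pos by simp
      moreover have "1 \<le> s * q n"
        using s qn by (simp add: Suc_le_eq)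
      then have "ln (real (s * q n)) \<ge> 0"
        by (metis ln_ge_zero of_nat_1 of_nat_le_iff)
      ultimately show ?case
        by (simp add: divide_right_mono)
    qed
  qed
  also have "\<dots> \<le> limsup ?f"
    using limsup_subseq_mono[OF sq, of ?f] by (simp add: o_def)
  finally show ?thesis .
qed

context unital_algebra
begin

section \<open>Finite-dimensional subspaces and their powers\<close>

lemma finite_dim_basis:
  assumes "finite_dim V"
  obtains B where "finite B" "B \<subseteq> V" "independent B" "V \<subseteq> span B" "card B = dim V"
proof -
  obtain C where C: "finite C" "V \<subseteq> span C"
    using assms by (auto simp: finite_dim_def)
  obtain B where B: "B \<subseteq> V" "independent B" "V \<subseteq> span B" "card B = dim V"
    using basis_exists by blast
  moreover have "finite B"
    using independent_span_bound[OF C(1) B(2)] B(1) C(2) by blast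
  ultimately show ?thesis
    using that by blast
qed

lemma dim_mono_finite_dim:
  assumes "V \<subseteq> U" "finite_dim U"
  shows "dim V \<le> dim U"
proof -
  obtain B where B: "finite B" "U \<subseteq> span B" "card B = dim U"
    using assms(2) finite_dim_basis by metis
  then show ?thesis
    using dim_le_card[of V B] assms(1) by auto
qed

lemma mult_span_subset:
  assumes "subspace S" "\<And>a b. a \<in> X \<Longrightarrow> b \<in> Y \<Longrightarrow> a * b \<in> S" "x \<in> span X" "y \<in> span Y"
  shows "x * y \<in> S"
proof -
  have left: "a * y \<in> S" if "a \<in> X" for a
    using assms(4)
  proof (induction rule: span_induct)
    case base
    have "subspace {b. a * b \<in> S}"
      using assms(1) by (auto simp: subspace_def distrib_left scale_mult_right)
    then show ?case by simp
  qed (use assms(2) that in auto)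
  show ?thesis
    using assms(3)
  proof (induction rule: span_induct)
    case base
    have "subspace {a. a * y \<in> S}"
      using assms(1) by (auto simp: subspace_def distrib_right scale_mult_left)
    then show ?case by simp
  qed (use left in auto)
qed

lemma subspace_subspace_power: "subspace (subspace_power V n)"
  by (simp add: subspace_power_def)

lemma prod_list_in_subspace_power:
  "length as = n \<Longrightarrow> set as \<subseteq> V \<Longrightarrow> prod_list as \<in> subspace_power V n"
  unfolding subspace_power_def by (rule span_base) auto

lemma subspace_power_mult:
  assumes "x \<in> subspace_power V m" "y \<in> subspace_power V n"
  shows "x * y \<in> subspace_power V (m + n)"
proof (rule mult_span_subset[OF subspace_subspace_power _ assms[unfolded subspace_power_def]])
  fix a b
  assume "a \<in> {prod_list as |as. length as = m \<and> set as \<subseteq> V}"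
    and "b \<in> {prod_list as |as. length as = n \<and> set as \<subseteq> V}"
  then obtain as bs where "a = prod_list as" "length as = m" "set as \<subseteq> V"
    "b = prod_list bs" "length bs = n" "set bs \<subseteq> V"
    by blast
  then show "a * b \<in> subspace_power V (m + n)"
    using prod_list_in_subspace_power[of "as @ bs" "m + n" V] by simp
qed

lemma one_in_subspace_power_0: "1 \<in> subspace_power V 0"
  using prod_list_in_subspace_power[of "[]"] by simp

lemma subset_subspace_power_1: "V \<subseteq> subspace_power V 1"
  using prod_list_in_subspace_power[of "[_]"] by force

lemma subspace_power_1:
  assumes "subspace V"
  shows "subspace_power V 1 = V"
proof
  have "{prod_list as |as. length as = 1 \<and> set as \<subseteq> V} \<subseteq> V"
    by (auto simp: length_Suc_conv)
  then show "subspace_power V 1 \<subseteq> V"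
    unfolding subspace_power_def using assms by (rule span_minimal)
qed (rule subset_subspace_power_1)

lemma subspace_power_mono:
  assumes "1 \<in> V" "m \<le> n"
  shows "subspace_power V m \<subseteq> subspace_power V n"
proof
  fix x assume x: "x \<in> subspace_power V m"
  have "1 \<in> subspace_power V k" for k
    using prod_list_in_subspace_power[of "replicate k 1" k V] assms(1)
    by (auto simp: set_replicate_conv_if)
  with x have "x * 1 \<in> subspace_power V (m + (n - m))"
    by (intro subspace_power_mult)
  then show "x \<in> subspace_power V n"
    using assms(2) by simp
qed

lemma subspace_power_subset_power:
  assumes "W \<subseteq> subspace_power V s"
  shows "subspace_power W n \<subseteq> subspace_power V (s * n)"
proof -
  have "prod_list as \<in> subspace_power V (s * length as)" if "set as \<subseteq> W" for as
    using that
  proof (induction as)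
    case Nil
    then show ?case by (simp add: one_in_subspace_power_0)
  next
    case (Cons a as)
    then have "a * prod_list as \<in> subspace_power V (s + s * length as)"
      using assms by (intro subspace_power_mult) auto
    then show ?case by simp
  qed
  then have "{prod_list as |as. length as = n \<and> set as \<subseteq> W} \<subseteq> subspace_power V (s * n)"
    by auto
  then show ?thesis
    unfolding subspace_power_def[of W] using subspace_subspace_power by (rule span_minimal)
qed

text \<open>Expanding every factor of a product in a basis \<open>B\<close> of \<open>V\<close> leaves the \<open>card B ^ n\<close> words of
  length \<open>n\<close> in \<open>B\<close> as a spanning set.\<close>

lemma subspace_power_span_words:
  assumes "V \<subseteq> span B"
  shows "subspace_power V n \<subseteq> span (prod_list ` {as. set as \<subseteq> B \<and> length as = n})"
proof -
  have "V \<subseteq> subspace_power B 1"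
    using assms span_minimal[OF subset_subspace_power_1 subspace_subspace_power] by blast
  then have "subspace_power V n \<subseteq> subspace_power B (1 * n)"
    by (rule subspace_power_subset_power)
  also have "subspace_power B (1 * n) = span (prod_list ` {as. set as \<subseteq> B \<and> length as = n})"
    unfolding subspace_power_def by (rule arg_cong[of _ _ span]) auto
  finally show ?thesis .
qed

lemma finite_dim_subspace_power:
  assumes "finite_dim V"
  shows "finite_dim (subspace_power V n)"
proof -
  obtain B where B: "finite B" "V \<subseteq> span B"
    using assms by (auto simp: finite_dim_def)
  have "finite (prod_list ` {as. set as \<subseteq> B \<and> length as = n})"
    using B(1) by (intro finite_imageI finite_lists_length_eq)
  then show ?thesis
    unfolding finite_dim_def using subspace_power_span_words[OF B(2)] by blast
qed

lemma dim_subspace_power_le: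
  assumes "finite_dim V"
  shows "dim (subspace_power V n) \<le> dim V ^ n"
proof -
  obtain B where B: "finite B" "V \<subseteq> span B" "card B = dim V"
    using assms finite_dim_basis by metis
  let ?L = "{as. set as \<subseteq> B \<and> length as = n}"
  have "dim (subspace_power V n) \<le> card (prod_list ` ?L)"
    using B by (intro dim_le_card subspace_power_span_words) (auto simp: finite_lists_length_eq)
  also have "\<dots> \<le> card ?L"
    using B by (intro card_image_le finite_lists_length_eq)
  also have "\<dots> = dim V ^ n"
    using B card_lists_length_eq by metis
  finally show ?thesis .
qed

section \<open>Generating subspaces\<close>

text \<open>The powers of a generating subspace form an increasing chain, whose union is a subalgebra;
  so they exhaust the algebra, and a finite-dimensional subspace is swallowed by one of them.\<close>

lemma finite_dim_subset_subspace_power: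
  assumes V: "generating_subspace V" and W: "finite_dim W"
  obtains s where "s > 0" "W \<subseteq> subspace_power V s"
proof -
  let ?U = "\<Union>n. subspace_power V n"
  have one: "1 \<in> V" and gen: "generates V"
    using V by (auto simp: generating_subspace_def)
  have "subspace ?U"
    unfolding subspace_def
  proof (intro conjI ballI allI)
    show "0 \<in> ?U"
      using subspace_0[OF subspace_subspace_power] by blast
  next
    fix x y assume "x \<in> ?U" "y \<in> ?U"
    then obtain m n where "x \<in> subspace_power V m" "y \<in> subspace_power V n"
      by blast
    then have "x \<in> subspace_power V (max m n)" "y \<in> subspace_power V (max m n)"
      using subspace_power_mono[OF one] by (meson max.cobounded1 max.cobounded2 subsetD)+
    then show "x + y \<in> ?U"
      using subspace_add[OF subspace_subspace_power] by blast
  next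
    fix c x assume "x \<in> ?U"
    then show "scale c x \<in> ?U"
      using subspace_scale[OF subspace_subspace_power] by blast
  qed
  moreover have "1 \<in> ?U"
    using one_in_subspace_power_0 by blast
  moreover have "x * y \<in> ?U" if xy: "x \<in> ?U" "y \<in> ?U" for x y
  proof -
    obtain m n where "x \<in> subspace_power V m" "y \<in> subspace_power V n"
      using xy by blast
    then have "x * y \<in> subspace_power V (m + n)"
      by (rule subspace_power_mult)
    then show ?thesis by blast
  qed
  ultimately have "subalgebra ?U"
    unfolding subalgebra_def by blast
  moreover have "V \<subseteq> ?U"
    using subset_subspace_power_1 by blast
  ultimately have "subalgebra hull V \<subseteq> ?U"
    by (intro hull_minimal)
  then have exhaust: "x \<in> ?U" for x
    using gen by (auto simp: generates_def)
  then obtain h where h: "\<And>x. x \<in> subspace_power V (h x)"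
    by (metis UN_E)
  obtain B where B: "finite B" "W \<subseteq> span B"
    using W by (auto simp: finite_dim_def)
  let ?s = "Suc (Max (h ` B))"
  have "b \<in> subspace_power V ?s" if "b \<in> B" for b
  proof -
    have "h b \<le> ?s"
      using B(1) that by (simp add: le_SucI)
    then show ?thesis
      using h subspace_power_mono[OF one] by blast
  qed
  then have "span B \<subseteq> subspace_power V ?s"
    using subspace_subspace_power by (intro span_minimal) auto
  then show ?thesis
    using that[of ?s] B(2) by blast
qed

lemma generating_subspace_exists:
  assumes affine
  shows "\<exists>V. generating_subspace V"
proof -
  obtain X where X: "finite X" "generates X"
    using assms by (auto simp: affine_def)
  let ?V = "span (insert 1 X)"
  have "X \<subseteq> ?V"
    using span_superset by blast
  then have "generates ?V"
    using X(2) hull_mono[of X ?V subalgebra] by (auto simp: generates_def)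
  moreover have "finite_dim ?V"
    using X(1) unfolding finite_dim_def by blast
  moreover have "1 \<in> ?V"
    by (simp add: span_base)
  ultimately have "generating_subspace ?V"
    by (simp add: generating_subspace_def)
  then show ?thesis ..
qed

section \<open>Homogeneous components\<close>

lemma span_UN_decompose:
  assumes D: "\<And>n. subspace (D n)" and x: "x \<in> span (\<Union>n. D n)"
  shows "\<exists>g. (\<forall>n. g n \<in> D n) \<and> finite {n. g n \<noteq> 0} \<and> x = (\<Sum>n | g n \<noteq> 0. g n)"
proof -
  \<comment> \<open>Summing over a finite set that only contains the support makes addition of two
    decompositions painless.\<close>
  define P where "P x \<longleftrightarrow>
    (\<exists>g N. (\<forall>n. g n \<in> D n) \<and> finite N \<and> (\<forall>n. n \<notin> N \<longrightarrow> g n = 0) \<and> x = sum g N)" for x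
  have "P x"
    using x
  proof (induction rule: span_induct)
    case base
    have "P 0"
      unfolding P_def by (intro exI[of _ "\<lambda>_. 0"] exI[of _ "{}"]) (use D subspace_0 in auto)
    moreover have "P (x + y)" if px: "P x" and py: "P y" for x y
    proof -
      obtain g N where g: "\<forall>n. g n \<in> D n" "finite N" "\<forall>n. n \<notin> N \<longrightarrow> g n = 0" "x = sum g N"
        using px unfolding P_def by blast
      obtain h M where h: "\<forall>n. h n \<in> D n" "finite M" "\<forall>n. n \<notin> M \<longrightarrow> h n = 0" "y = sum h M"
        using py unfolding P_def by blast
      have "x = sum g (N \<union> M)" "y = sum h (N \<union> M)"
        using g h by (auto intro!: sum.mono_neutral_left)
      then have "x + y = (\<Sum>n\<in>N \<union> M. g n + h n)"
        by (simp add: sum.distrib)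
      moreover have "\<forall>n. g n + h n \<in> D n"
        using g h subspace_add[OF D] by blast
      moreover have "finite (N \<union> M)" "\<forall>n. n \<notin> N \<union> M \<longrightarrow> g n + h n = 0"
        using g h by auto
      ultimately show ?thesis
        unfolding P_def by (intro exI[of _ "\<lambda>n. g n + h n"] exI[of _ "N \<union> M"] conjI)
    qed
    moreover have "P (scale c x)" if px: "P x" for c x
    proof -
      obtain g N where g: "\<forall>n. g n \<in> D n" "finite N" "\<forall>n. n \<notin> N \<longrightarrow> g n = 0" "x = sum g N"
        using px unfolding P_def by blast
      have "scale c x = (\<Sum>n\<in>N. scale c (g n))"
        using g by (simp add: scale_sum_right)
      moreover have "\<forall>n. scale c (g n) \<in> D n"
        using g subspace_scale[OF D] by blast
      moreover have "\<forall>n. n \<notin> N \<longrightarrow> scale c (g n) = 0"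
        using g by simp
      ultimately show ?thesis
        unfolding P_def using g(2) by (intro exI[of _ "\<lambda>n. scale c (g n)"] exI[of _ N] conjI)
    qed
    ultimately show ?case
      by (simp add: subspace_def)
  next
    case (step x)
    then obtain n where "x \<in> D n"
      by blast
    then show ?case
      unfolding P_def using subspace_0[OF D]
      by (intro exI[of _ "\<lambda>m. if m = n then x else 0"] exI[of _ "{n}"]) auto
  qed
  then obtain g N where g: "\<forall>n. g n \<in> D n" "finite N" "\<forall>n. n \<notin> N \<longrightarrow> g n = 0" "x = sum g N"
    unfolding P_def by blast
  have sub: "{n. g n \<noteq> 0} \<subseteq> N"
    using g(3) by blast
  then have "x = (\<Sum>n | g n \<noteq> 0. g n)"
    unfolding g(4) using g(2) by (intro sum.mono_neutral_right) auto
  then show ?thesis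
    using g(1) finite_subset[OF sub g(2)] by blast
qed

text \<open>By uniqueness, a decomposition of \<open>x\<close> with parts in the \<open>D n\<close> has \<open>x\<close> itself as its only part.\<close>

lemma graded_homogeneous_in_span_UN:
  assumes A: "graded A" and D: "\<And>n. subspace (D n)" "\<And>n. D n \<subseteq> A n"
    and x: "x \<in> A n" "x \<in> span (\<Union>n. D n)"
  shows "x \<in> D n"
proof -
  define decomp where "decomp f \<longleftrightarrow>
    (\<forall>n. f n \<in> A n) \<and> finite {n. f n \<noteq> 0} \<and> x = (\<Sum>n | f n \<noteq> 0. f n)" for f
  obtain g where g: "\<forall>n. g n \<in> D n" "finite {n. g n \<noteq> 0}" "x = (\<Sum>n | g n \<noteq> 0. g n)"
    using span_UN_decompose[OF D(1) x(2)] by blast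
  have "decomp g"
    using g D(2) unfolding decomp_def by blast
  moreover have "decomp (\<lambda>m. if m = n then x else 0)"
  proof -
    have "(if m = n then x else 0) \<in> A m" for m
      using A x(1) subspace_0 by (auto simp: graded_def)
    moreover have "{m. (if m = n then x else 0) \<noteq> 0} = (if x = 0 then {} else {n})"
      by auto
    ultimately show ?thesis
      by (simp add: decomp_def)
  qed
  moreover have "\<exists>!f. decomp f"
    using A unfolding graded_def decomp_def by blast
  ultimately have "g = (\<lambda>m. if m = n then x else 0)"
    by blast
  then have "g n = x"
    by simp
  then show ?thesis
    using g(1) by metis
qed

lemma finite_dim_subset_span_components:
  assumes A: "graded A" and V: "finite_dim V"
  shows "\<exists>r. V \<subseteq> span (\<Union>i\<le>r. A i)"
proof -
  have "\<exists>r. x \<in> span (\<Union>i\<le>r. A i)" for x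
  proof -
    have "\<exists>!f. (\<forall>n. f n \<in> A n) \<and> finite {n. f n \<noteq> 0} \<and> x = (\<Sum>n | f n \<noteq> 0. f n)"
      using A unfolding graded_def by blast
    then obtain f where f: "\<forall>n. f n \<in> A n" "finite {n. f n \<noteq> 0}" "x = (\<Sum>n | f n \<noteq> 0. f n)"
      by blast
    obtain r where r: "\<And>n. f n \<noteq> 0 \<Longrightarrow> n \<le> r"
      using f(2) unfolding finite_nat_set_iff_bounded_le by blast
    have "x \<in> span (\<Union>i\<le>r. A i)"
      unfolding f(3) using f(1) r by (intro span_sum span_base) blast
    then show ?thesis ..
  qed
  then obtain h where h: "\<And>x. x \<in> span (\<Union>i\<le>h x. A i)"
    by metis
  obtain B where B: "finite B" "V \<subseteq> span B"
    using V by (auto simp: finite_dim_def)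
  let ?r = "Max (h ` B)"
  have "b \<in> span (\<Union>i\<le>?r. A i)" if "b \<in> B" for b
  proof -
    have "h b \<le> ?r"
      using B(1) that by simp
    then have "(\<Union>i\<le>h b. A i) \<subseteq> (\<Union>i\<le>?r. A i)"
      by force
    then show ?thesis
      using h[of b] span_mono by blast
  qed
  then have "span B \<subseteq> span (\<Union>i\<le>?r. A i)"
    by (intro span_minimal) auto
  then show ?thesis
    using B(2) by blast
qed

lemma finite_dim_span_components:
  assumes "\<And>n. finite_dim (A n)"
  shows "finite_dim (span (\<Union>i\<le>(r::nat). A i))"
proof -
  have "\<forall>n. \<exists>B. finite B \<and> A n \<subseteq> span B"
    using assms by (simp add: finite_dim_def)
  then obtain B where B: "\<And>n. finite (B n)" "\<And>n. A n \<subseteq> span (B n)"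
    by metis
  have "A i \<subseteq> span (\<Union>i\<le>r. B i)" if "i \<le> r" for i
    using B(2)[of i] span_mono[of "B i" "\<Union>i\<le>r. B i"] that by blast
  then have "span (\<Union>i\<le>r. A i) \<subseteq> span (\<Union>i\<le>r. B i)"
    by (intro span_minimal) auto
  moreover have "finite (\<Union>i\<le>r. B i)"
    using B(1) by simp
  ultimately show ?thesis
    unfolding finite_dim_def by blast
qed

section \<open>Components inside powers\<close>

text \<open>The sum \<open>T\<close> of the subspaces \<open>A n \<inter> W ^ max n 1\<close> is a subalgebra, and it contains the
  generators because \<open>1 \<in> W\<close> gives \<open>A i \<subseteq> W \<subseteq> W ^ max i 1\<close> for \<open>i \<le> r\<close>. So \<open>T\<close> is everything, and
  comparing components gives the claim. The exponent cannot be \<open>n\<close> itself in degree 0, as \<open>A 0\<close> may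
  be larger than the scalars; closure under multiplication by \<open>A 0\<close> is where elements of degree 0
  are absorbed, by \<open>A 0 * W \<subseteq> W\<close> and \<open>W * A 0 \<subseteq> W\<close>.\<close>

lemma component_subset_subspace_power:
  assumes A: "graded A" and W: "W = span (\<Union>i\<le>r. A i)"
    and gen: "generates W" and one: "1 \<in> W"
  shows "A n \<subseteq> subspace_power W (max n 1)"
proof -
  define D where "D n = A n \<inter> subspace_power W (max n 1)" for n
  have subA: "subspace (A i)" for i
    using A unfolding graded_def by blast
  have multA: "x * y \<in> A (i + j)" if "x \<in> A i" "y \<in> A j" for x y i j
    using A that unfolding graded_def by blast
  have subW: "subspace W"
    by (simp add: W)
  have W1: "subspace_power W 1 = W"
    using subW by (rule subspace_power_1)
  have A_W: "A i \<subseteq> W" if "i \<le> r" for i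
    unfolding W using that span_superset by fastforce
  have left: "a * w \<in> W" if "a \<in> A 0" "w \<in> W" for a w
  proof (rule mult_span_subset[OF subW, of "A 0" "\<Union>i\<le>r. A i"])
    fix x y assume "x \<in> A 0" "y \<in> (\<Union>i\<le>r. A i)"
    then obtain i where "i \<le> r" "x * y \<in> A i"
      using multA[of x 0 y] by force
    then show "x * y \<in> W"
      using A_W by blast
  qed (use that in \<open>auto simp: W span_base\<close>)
  have right: "w * a \<in> W" if "a \<in> A 0" "w \<in> W" for a w
  proof (rule mult_span_subset[OF subW, of "\<Union>i\<le>r. A i" "A 0"])
    fix x y assume "x \<in> (\<Union>i\<le>r. A i)" "y \<in> A 0"
    then obtain i where "i \<le> r" "x * y \<in> A i"
      using multA[of x _ y 0] by force
    then show "x * y \<in> W"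
      using A_W by blast
  qed (use that in \<open>auto simp: W span_base\<close>)
  have left_power: "a * x \<in> subspace_power W (Suc n)"
    if a: "a \<in> A 0" and x: "x \<in> subspace_power W (Suc n)" for a x n
  proof (rule mult_span_subset[OF subspace_subspace_power, of "{a}"])
    fix u v assume "u \<in> {a}" "v \<in> {prod_list as |as. length as = Suc n \<and> set as \<subseteq> W}"
    then obtain w ws where ws: "u = a" "v = w * prod_list ws" "length ws = n" "w \<in> W" "set ws \<subseteq> W"
      by (auto simp: length_Suc_conv)
    then have "prod_list ((a * w) # ws) \<in> subspace_power W (Suc n)"
      using left[OF a] by (intro prod_list_in_subspace_power) auto
    then show "u * v \<in> subspace_power W (Suc n)"
      by (simp add: ws mult.assoc)
  qed (use x in \<open>auto simp: subspace_power_def span_base\<close>)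
  have right_power: "x * a \<in> subspace_power W (Suc n)"
    if a: "a \<in> A 0" and x: "x \<in> subspace_power W (Suc n)" for a x n
  proof (rule mult_span_subset[OF subspace_subspace_power, of _ "{a}"])
    fix u v assume "u \<in> {prod_list as |as. length as = Suc n \<and> set as \<subseteq> W}" "v \<in> {a}"
    then obtain w ws where ws: "v = a" "u = prod_list ws * w" "length ws = n" "w \<in> W" "set ws \<subseteq> W"
      by (auto simp: length_Suc_conv_rev)
    then have "prod_list (ws @ [w * a]) \<in> subspace_power W (Suc n)"
      using right[OF a] by (intro prod_list_in_subspace_power) auto
    then show "u * v \<in> subspace_power W (Suc n)"
      by (simp add: ws mult.assoc)
  qed (use x in \<open>auto simp: subspace_power_def span_base\<close>)
  have subD: "subspace (D n)" for n
    unfolding D_def using subA subspace_subspace_power by (rule subspace_inter)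
  have multD: "x * y \<in> D (m + n)" if x: "x \<in> D m" and y: "y \<in> D n" for x y m n
  proof -
    have "x * y \<in> subspace_power W (max (m + n) 1)"
    proof (cases "m = 0 \<or> n = 0")
      case True
      then show ?thesis
      proof
        assume "m = 0"
        then show ?thesis
          using x y left_power[of x y "max n 1 - 1"] by (simp add: D_def)
      next
        assume "n = 0"
        then show ?thesis
          using x y right_power[of y x "max m 1 - 1"] by (simp add: D_def)
      qed
    next
      case False
      then have "max m 1 = m" "max n 1 = n" "max (m + n) 1 = m + n"
        by auto
      then show ?thesis
        using x y subspace_power_mult[of x W m y n] by (simp add: D_def)
    qed
    then show ?thesis
      using x y multA by (auto simp: D_def)
  qed
  define T where "T = span (\<Union>n. D n)"
  have "A i \<subseteq> D i" if "i \<le> r" for i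
    using A_W[OF that] subspace_power_mono[OF one, of 1 "max i 1"] unfolding W1
    by (auto simp: D_def)
  then have W_T: "W \<subseteq> T"
    unfolding W T_def by (intro span_mono) blast
  have "x * y \<in> T" if "x \<in> T" "y \<in> T" for x y
  proof (rule mult_span_subset[OF _ _ that[unfolded T_def]])
    show "subspace T"
      by (simp add: T_def)
    show "a * b \<in> T" if "a \<in> (\<Union>n. D n)" "b \<in> (\<Union>n. D n)" for a b
      using that multD unfolding T_def by (blast intro: span_base)
  qed
  then have "subalgebra T"
    using W_T one by (auto simp: subalgebra_def T_def)
  then have "subalgebra hull W \<subseteq> T"
    using W_T by (intro hull_minimal)
  then have exhaust: "x \<in> span (\<Union>n. D n)" for x
    using gen by (auto simp: generates_def T_def)
  have "A n \<subseteq> D n"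
  proof
    fix x assume "x \<in> A n"
    moreover have "D m \<subseteq> A m" for m
      by (simp add: D_def)
    ultimately show "x \<in> D n"
      using graded_homogeneous_in_span_UN[where D = D, OF A subD _ _ exhaust] by blast
  qed
  then show ?thesis
    by (auto simp: D_def)
qed

section \<open>The superdimension\<close>

text \<open>The factor \<open>s\<close> is an exponent for which \<open>V ^ s\<close> contains \<open>A 0 + \<dots> + A r\<close>.\<close>

lemma dim_component_le_dim_subspace_power:
  assumes A: "graded A" "\<And>n. finite_dim (A n)" and V: "generating_subspace V"
  shows "\<exists>s>0. \<forall>n>0. dim (A n) \<le> dim (subspace_power V (s * n))"
proof -
  have V': "finite_dim V" "1 \<in> V" "generates V"
    using V by (auto simp: generating_subspace_def)
  obtain r where r: "V \<subseteq> span (\<Union>i\<le>r. A i)"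
    using finite_dim_subset_span_components[OF A(1) V'(1)] by blast
  define W where "W = span (\<Union>i\<le>r. A i)"
  have "1 \<in> W" "generates W"
    using r V' hull_mono[of V W subalgebra] by (auto simp: W_def generates_def)
  then have AW: "A n \<subseteq> subspace_power W (max n 1)" for n
    using component_subset_subspace_power[OF A(1) W_def] by blast
  have "finite_dim W"
    unfolding W_def using A(2) by (rule finite_dim_span_components)
  then obtain s where s: "s > 0" "W \<subseteq> subspace_power V s"
    using finite_dim_subset_subspace_power[OF V] by blast
  have "dim (A n) \<le> dim (subspace_power V (s * n))" if "n > 0" for n
  proof (rule dim_mono_finite_dim)
    have "max n 1 = n"
      using that by simp
    then show "A n \<subseteq> subspace_power V (s * n)"
      using AW[of n] subspace_power_subset_power[OF s(2), of n] by simp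
  qed (rule finite_dim_subspace_power[OF V'(1)])
  then show ?thesis
    using s(1) by blast
qed

lemma superdim_wrt_le_1:
  assumes "finite_dim V"
  shows "superdim_wrt V \<le> 1"
  unfolding superdim_wrt_def
proof (rule limsup_ln_ln_ratio_le_1)
  \<comment> \<open>Adding 3 makes \<open>ln (ln C)\<close> nonnegative even when \<open>dim V\<close> is 1 or 2.\<close>
  let ?C = "real (dim V + 3)"
  show "?C \<ge> 3" by simp
  fix n
  have "dim (subspace_power V n) \<le> dim V ^ n"
    using assms by (rule dim_subspace_power_le)
  also have "\<dots> \<le> (dim V + 3) ^ n"
    by (intro power_mono) auto
  finally show "real (dim (subspace_power V n)) \<le> ?C ^ n"
    by (metis of_nat_le_iff of_nat_power)
qed

lemma entropy_gt_1_frequently: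
  assumes "entropy A > 1"
  shows "\<exists>c>1. \<exists>\<^sub>F n in sequentially. n > 0 \<and> c ^ n \<le> real (dim (A n))"
proof -
  obtain c where c: "1 < ereal c" "ereal c < entropy A"
    using ereal_dense2[OF assms] by blast
  have "\<exists>\<^sub>F n in sequentially. n > 0 \<and> c ^ n \<le> real (dim (A n))"
  proof (rule ccontr)
    assume "\<not> ?thesis"
    then have "\<forall>\<^sub>F n in sequentially. \<not> (n > 0 \<and> c ^ n \<le> real (dim (A n)))"
      by (simp add: not_frequently)
    then have "\<forall>\<^sub>F n in sequentially. ereal (root n (real (dim (A n)))) \<le> ereal c"
      using eventually_gt_at_top[of 0]
    proof eventually_elim
      case (elim n)
      then have "real (dim (A n)) \<le> c ^ n"
        by simp
      then have "root n (real (dim (A n))) \<le> root n (c ^ n)"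
        using elim(2) by simp
      also have "\<dots> = c"
        using elim(2) c(1) by (intro real_root_power_cancel) auto
      finally show ?case by simp
    qed
    then have "entropy A \<le> ereal c"
      unfolding entropy_def by (rule Limsup_bounded)
    then show False
      using c(2) by simp
  qed
  then show ?thesis
    using c(1) by auto
qed

lemma superdim_wrt_ge_1:
  assumes A: "graded A" "\<And>n. finite_dim (A n)" and entropy: "entropy A > 1"
    and V: "generating_subspace V"
  shows "superdim_wrt V \<ge> 1"
proof -
  obtain s where s: "s > 0" "\<And>n. n > 0 \<Longrightarrow> dim (A n) \<le> dim (subspace_power V (s * n))"
    using dim_component_le_dim_subspace_power[OF A V] by blast
  obtain c where c: "c > 1" "\<exists>\<^sub>F n in sequentially. n > 0 \<and> c ^ n \<le> real (dim (A n))"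
    using entropy_gt_1_frequently[OF entropy] by blast
  have "\<exists>\<^sub>F n in sequentially. c ^ n \<le> real (dim (subspace_power V (s * n)))"
    using c(2) by (rule frequently_elim1) (use s(2) of_nat_mono order_trans in blast)
  then show ?thesis
    unfolding superdim_wrt_def by (rule limsup_ln_ln_ratio_ge_1[OF c(1) s(1)])
qed

end

theorem corollary5p5:
  fixes scale :: "'k::field \<Rightarrow> 'a::ring_1 \<Rightarrow> 'a"
    and A :: "nat \<Rightarrow> 'a set"
  assumes "unital_algebra scale"
    and "unital_algebra.affine scale"
    and "unital_algebra.graded scale A"
    and "\<And>n. unital_algebra.finite_dim scale (A n)"
    and "unital_algebra.entropy scale A > 1"
  shows "unital_algebra.GK_superdim scale = 1"
proof -
  interpret unital_algebra scale
    by (rule assms(1))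
  have all: "superdim_wrt V = 1" if "generating_subspace V" for V
  proof (rule antisym)
    show "superdim_wrt V \<le> 1"
      using that by (intro superdim_wrt_le_1) (simp add: generating_subspace_def)
    show "superdim_wrt V \<ge> 1"
      using assms(3-5) that by (rule superdim_wrt_ge_1)
  qed
  obtain V where "generating_subspace V"
    using generating_subspace_exists[OF assms(2)] by blast
  with all show ?thesis
    unfolding GK_superdim_def by (intro the_equality) auto
qed

end
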